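(* Let $n\ge 2$ and let $\pi:S_n\to S_{n-1}$ be the deletion map erasing the letter $n$. The pre-Reeb graph $R(\pi)$ has vertex set canonically identified with the power set $\mathcal P([n-1])$, via $[w]\mapsto A(w):=\{i\in[n-1]\mid n \text{ occurs to the left of } i \text{ in } w\}$. Under this identification, the edges are precisely $$A\longrightarrow A\cup\{a\}\qquad (A\subseteq[n-1],\ a\in[n-1]\setminus A).$$ In particular, $R(\pi)$ is the Hasse diagram of the Boolean lattice $(\mathcal P([n-1]),\subseteq)$, and hence $\mathsf{Reeb}(\pi)\cong(\mathcal P([n-1]),\subseteq)$.
   Context: $[m]=\{1,\dots,m\}$. $S_n$ is the set of permutations written as words on $\{1,\dots,n\}$ (each letter used once), with the (right) weak order: the poset whose cover relations $u\to v$ are the swaps of adjacent letters $\cdots a\,b\cdots\mapsto\cdots b\,a\cdots$ with $a<b$. The map $\pi:S_n\to S_{n-1}$ deletes the letter $n$ from the word. For every cover $v\to w$ in $S_n$, either $\pi(v)=\pi(w)$ (the cover is called vertical) or $\pi(v)\to\pi(w)$ is a cover in $S_{n-1}$ (the cover is called horizontal). Let $\sim_h$ be the equivalence relation on $S_n$ generated by $v\sim_h w$ for horizontal covers $v\to w$; $[v]$ denotes the class of $v$. The pre-Reeb graph $R(\pi)$ is the directed graph whose vertices are the $\sim_h$-classes, with an edge $[v]\to[w]$ whenever there are $v'\in[v]$, $w'\in[w]$ such that $v'\to w'$ is a vertical cover. When $R(\pi)$ is acyclic, the Reeb poset $\mathsf{Reeb}(\pi)$ is the reachability poset of $R(\pi)$: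 the vertex set with $x\le y$ iff there is a directed path (possibly of length 0) from $x$ to $y$ in $R(\pi)$. *)

theory Defs
  imports "HOL-Combinatorics.Multiset_Permutations" "Graph_Theory.Pair_Digraph"
begin

text \<open>Words are lists of naturals; \<open>S\<^sub>n\<close> is \<^term>\<open>permutations_of_set {1..n}\<close>.
  The weak order enters only through its cover relations.\<close>

definition weak_graph :: "nat \<Rightarrow> nat list pair_pre_digraph" where
  "weak_graph n = \<lparr>
     pverts = permutations_of_set {1..n},
     parcs = {(u, v). u \<in> permutations_of_set {1..n} \<and> v \<in> permutations_of_set {1..n} \<and>
               (\<exists>xs ys a b. a < b \<and> u = xs @ [a, b] @ ys \<and> v = xs @ [b, a] @ ys)} \<rparr>"

definition deletion :: "nat \<Rightarrow> nat list \<Rightarrow> nat list" where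
  "deletion n w = removeAll n w"

context
  fixes G :: "'a pair_pre_digraph" and H :: "'b pair_pre_digraph" and f :: "'a \<Rightarrow> 'b"
begin

definition horizontal :: "'a rel" where
  "horizontal = {(v, w) \<in> parcs G. (f v, f w) \<in> parcs H}"

definition vertical :: "'a rel" where
  "vertical = {(v, w) \<in> parcs G. f v = f w}"

text \<open>\<^const>\<open>equivclp\<close> closes over the whole type, so it is restricted to the vertices.\<close>

definition hrel :: "'a rel" where
  "hrel = {(v, w). v \<in> pverts G \<and> w \<in> pverts G \<and> equivclp (\<lambda>x y. (x, y) \<in> horizontal) v w}"

definition pre_reeb :: "'a set pair_pre_digraph" where
  "pre_reeb = \<lparr>
     pverts = pverts G // hrel,
     parcs = {(X, Y). X \<in> pverts G // hrel \<and> Y \<in> pverts G // hrel \<and>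
               (\<exists>v\<in>X. \<exists>w\<in>Y. (v, w) \<in> vertical)} \<rparr>"

end

text \<open>The order relation of the Reeb poset when the graph \<open>R\<close> is acyclic.
  \<^const>\<open>reachable\<close> is reflexive exactly on the vertices.\<close>

definition reachability_order :: "'a pair_pre_digraph \<Rightarrow> 'a rel" where
  "reachability_order R = {(x, y). reachable (with_proj R) x y}"

definition hasse_diagram :: "'a rel \<Rightarrow> 'a pair_pre_digraph" where
  "hasse_diagram r = \<lparr>
     pverts = Field r,
     parcs = {(x, y) \<in> r. x \<noteq> y \<and> (\<forall>z. (x, z) \<in> r \<and> (z, y) \<in> r \<longrightarrow> z = x \<or> z = y)} \<rparr>"

definition boolean_lattice :: "'a set \<Rightarrow> 'a set rel" where
  "boolean_lattice U = {(A, B). A \<in> Pow U \<and> B \<in> Pow U \<and> A \<subseteq> B}"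

definition relabel :: "('a \<Rightarrow> 'b) \<Rightarrow> 'a pair_pre_digraph \<Rightarrow> 'b pair_pre_digraph" where
  "relabel \<phi> G = \<lparr> pverts = \<phi> ` pverts G, parcs = map_prod \<phi> \<phi> ` parcs G \<rparr>"

text \<open>The set \<open>A(w)\<close> of letters to the right of \<open>n\<close>.\<close>

definition right_of :: "nat \<Rightarrow> nat list \<Rightarrow> nat set" where
  "right_of n w = {i \<in> {1..n - 1}. \<exists>p q. p < q \<and> q < length w \<and> w ! p = n \<and> w ! q = i}"

end

theory Submission
  imports Defs
begin

text \<open>
  Write a permutation as \<open>p n q\<close>, so that \<open>A(p n q)\<close> is the set of letters of \<open>q\<close>. A cover of the
  weak order exchanges two adjacent letters \<open>a < b\<close>. If \<open>b < n\<close>, deleting \<open>n\<close> leaves the exchange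
  visible and the cover is horizontal; it takes place inside \<open>p\<close> or inside \<open>q\<close>, so \<open>A\<close> does not
  change. If \<open>b = n\<close>, the deletion hides the exchange and the cover is vertical; \<open>n\<close> jumps to the
  left over \<open>a\<close>, so \<open>A\<close> gains exactly the element \<open>a\<close>.

  Conversely, two permutations with the same \<open>A\<close> have left parts with the same letters and right
  parts with the same letters, and adjacent swaps sort one part into the other
  (\<open>adj_swaps_if_mset_eq\<close>). Hence the horizontal classes are precisely the fibres of \<open>A\<close>
  (\<open>hrel_eq_kernel_right_of\<close>), and \<open>A\<close> descends to a bijection from the classes to the subsets of
  \<open>{1..n - 1}\<close>. The vertical covers realise every arc \<open>A \<rightarrow> A \<union> {a}\<close>: list the remaining letters, then
  \<open>a\<close>, then \<open>n\<close>, then the letters of \<open>A\<close>, and exchange \<open>a\<close> with \<open>n\<close> (\<open>right_of_vertical\<close>).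

  Everything else holds for any graph whose vertices are labelled bijectively by the subsets of a
  finite set, with these arcs: labels grow strictly along arcs, which gives acyclicity, and a
  larger subset is reached by inserting its extra elements one at a time (\<open>reachability_order_iff\<close>).
\<close>

section \<open>Adjacent swaps\<close>

definition adj_swap :: "'a list rel" where
  "adj_swap = {(us @ a # b # vs, us @ b # a # vs) | us a b vs. True}"

lemma adj_swap_mset: "(xs, ys) \<in> adj_swap \<Longrightarrow> mset xs = mset ys"
  by (auto simp: adj_swap_def)

lemma adj_swaps_mset: "(xs, ys) \<in> adj_swap\<^sup>* \<Longrightarrow> mset xs = mset ys"
  by (induction rule: rtrancl_induct) (auto dest: adj_swap_mset)

lemma adj_swaps_Cons: "(xs, ys) \<in> adj_swap\<^sup>* \<Longrightarrow> (x # xs, x # ys) \<in> adj_swap\<^sup>*"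
proof (induction rule: rtrancl_induct)
  case (step ys zs)
  have "(x # ys, x # zs) \<in> adj_swap"
    using step.hyps(2) unfolding adj_swap_def by simp (metis append_Cons)
  with step.IH show ?case by (rule rtrancl_into_rtrancl)
qed simp

lemma adj_swaps_move_to_front: "(us @ x # vs, x # us @ vs) \<in> adj_swap\<^sup>*"
proof (induction us)
  case (Cons u us)
  have "(u # us @ x # vs, u # x # us @ vs) \<in> adj_swap\<^sup>*"
    using Cons.IH by (rule adj_swaps_Cons)
  also have "(u # x # us @ vs, x # u # us @ vs) \<in> adj_swap"
    unfolding adj_swap_def by simp (metis append_Nil)
  finally show ?case by simp
qed simp

text \<open>Insertion by bubbling: the wanted first letter is moved to the front, and the tail is
  rearranged by induction.\<close>

lemma adj_swaps_if_mset_eq: "mset xs = mset ys \<Longrightarrow> (xs, ys) \<in> adj_swap\<^sup>*"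
proof (induction ys arbitrary: xs)
  case (Cons y ys)
  then have "y \<in> set xs" by (metis list.set_intros(1) mset_eq_setD)
  then obtain us vs where xs: "xs = us @ y # vs" by (meson split_list)
  with Cons.prems have "(us @ vs, ys) \<in> adj_swap\<^sup>*"
    by (intro Cons.IH) simp
  then have "(y # us @ vs, y # ys) \<in> adj_swap\<^sup>*" by (rule adj_swaps_Cons)
  with adj_swaps_move_to_front show ?case unfolding xs by (rule rtrancl_trans)
qed simp

section \<open>Permutations split at their largest letter\<close>

lemma permutations_mset_cong:
  "mset xs = mset ys \<Longrightarrow> xs \<in> permutations_of_set A \<longleftrightarrow> ys \<in> permutations_of_set A"
  by (auto simp: permutations_of_set_def dest: mset_eq_setD mset_eq_imp_distinct_iff)

lemma permutation_split:
  fixes n :: nat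
  assumes "w \<in> permutations_of_set {1..n}" and "n \<ge> 1"
  obtains p q where "w = p @ n # q"
proof -
  have "n \<in> set w" using assms by (auto simp: permutations_of_set_def)
  then show thesis using that by (meson split_list)
qed

lemma right_of_split:
  assumes "p @ n # q \<in> permutations_of_set {1..n}"
  shows "right_of n (p @ n # q) = set q"
proof (intro set_eqI iffI)
  let ?w = "p @ n # q"
  have d: "distinct ?w" and s: "set ?w = {1..n}"
    using assms by (auto simp: permutations_of_set_def)
  fix i
  {
    assume "i \<in> right_of n ?w"
    then obtain k l where kl: "k < l" "l < length ?w" "?w ! k = n" "?w ! l = i"
      by (auto simp: right_of_def)
    have "?w ! length p = n" "length p < length ?w" by simp_all
    \<comment> \<open>The letter \<open>n\<close> occurs only once, so the left index must point to it.\<close>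
    then have "k = length p"
      using nth_eq_iff_index_eq[OF d, of k "length p"] kl less_trans[OF kl(1,2)] by metis
    with kl have "?w ! l = q ! (l - Suc k)" "l - Suc k < length q"
      by (simp_all add: nth_append nth_Cons')
    with kl show "i \<in> set q" by (metis nth_mem)
  next
    assume i: "i \<in> set q"
    then obtain m where m: "m < length q" "q ! m = i" by (auto simp: in_set_conv_nth)
    have "i \<in> {1..n}" "i \<noteq> n" using i s d by auto
    then have "i \<in> {1..n - 1}" unfolding atLeastAtMost_iff by linarith
    moreover have "?w ! length p = n" "?w ! (length p + Suc m) = i"
      "length p < length p + Suc m" "length p + Suc m < length ?w"
      using m by (simp_all add: nth_append)
    ultimately show "i \<in> right_of n ?w" unfolding right_of_def by blast
  }
qed

lemma atLeastAtMost_eq_insert_last: "n \<ge> 1 \<Longrightarrow> {1..n} = insert n {1..n - 1}" for n :: nat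
  by (cases n) (simp_all add: atLeastAtMostSuc_conv)

lemma parts_of_split:
  fixes n :: nat
  assumes "p @ n # q \<in> permutations_of_set {1..n}"
  shows "set p = {1..n - 1} - set q" and "set q \<subseteq> {1..n - 1}"
proof -
  have s: "set p \<union> insert n (set q) = {1..n}"
    and d: "n \<notin> set p" "n \<notin> set q" "set p \<inter> set q = {}"
    using permutations_of_setD[OF assms] by simp_all
  have "n \<in> {1..n}" using s by blast
  then have "n \<ge> 1" by simp
  then have "insert n (set p \<union> set q) = insert n {1..n - 1}" and "n \<notin> {1..n - 1}"
    using s atLeastAtMost_eq_insert_last[of n] by simp_all
  then have "{1..n - 1} = set p \<union> set q"
    using d by (metis Un_iff insert_ident)
  then show "set p = {1..n - 1} - set q" "set q \<subseteq> {1..n - 1}"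
    using d(3) by auto
qed

text \<open>The converse of the previous lemma. It is the source of all witnesses: the right part can be
  prescribed freely.\<close>

lemma permutation_with_right_part:
  fixes n :: nat
  assumes "n \<ge> 1" "set p = {1..n - 1} - set q" "set q \<subseteq> {1..n - 1}" "distinct p" "distinct q"
  shows "p @ n # q \<in> permutations_of_set {1..n}"
proof (rule permutations_of_setI)
  have n: "n \<notin> {1..n - 1}" using assms(1) by simp
  have "set (p @ n # q) = insert n (set p \<union> set q)" by simp
  also have "set p \<union> set q = {1..n - 1}" using assms(2,3) by blast
  finally show "set (p @ n # q) = {1..n}" using atLeastAtMost_eq_insert_last[OF assms(1)] by simp
  have "n \<notin> set p" "n \<notin> set q" "set p \<inter> set q = {}" using n assms(2,3) by blast+
  then show "distinct (p @ n # q)" using assms(4,5) by simp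
qed

lemma range_right_of:
  assumes "n \<ge> 1"
  shows "right_of n ` permutations_of_set {1..n} = Pow {1..n - 1}"
proof (intro equalityI subsetI)
  fix A assume "A \<in> Pow {1..n - 1}"
  then have A: "A \<subseteq> {1..n - 1}" "finite A" using finite_subset by auto
  let ?p = "sorted_list_of_set ({1..n - 1} - A)" and ?q = "sorted_list_of_set A"
  have "?p @ n # ?q \<in> permutations_of_set {1..n}"
    using assms A by (intro permutation_with_right_part) auto
  moreover from this have "right_of n (?p @ n # ?q) = A"
    using A by (simp add: right_of_split)
  ultimately show "A \<in> right_of n ` permutations_of_set {1..n}" by (metis imageI)
qed (auto simp: right_of_def)

section \<open>Horizontal and vertical covers\<close>

lemma deletion_permutation:
  assumes "w \<in> permutations_of_set {1..n}"
  shows "deletion n w \<in> permutations_of_set {1..n - 1}"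
proof (rule permutations_of_setI)
  have "{1..n} - {n} = {1..n - 1}" by auto
  then show "set (deletion n w) = {1..n - 1}"
    using permutations_of_setD(1)[OF assms] by (simp add: deletion_def)
  show "distinct (deletion n w)"
    using permutations_of_setD(2)[OF assms] by (simp add: deletion_def distinct_removeAll)
qed

lemma pverts_weak_graph: "pverts (weak_graph n) = permutations_of_set {1..n}"
  by (simp add: weak_graph_def)

lemma weak_graph_irrefl: "(v, v) \<notin> parcs (weak_graph n)"
  by (auto simp: weak_graph_def)

text \<open>If \<open>n\<close> takes part in the swap, both words have the same image, and a loop is not a cover.
  If it does not, the two letters stay adjacent in the shorter word.\<close>

lemma horizontal_deletion_iff:
  "(v, w) \<in> horizontal (weak_graph n) (weak_graph (n - 1)) (deletion n) \<longleftrightarrow>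
     v \<in> permutations_of_set {1..n} \<and> w \<in> permutations_of_set {1..n} \<and>
     (\<exists>us vs a b. a < b \<and> b < n \<and> v = us @ a # b # vs \<and> w = us @ b # a # vs)"
  (is "?L \<longleftrightarrow> ?R")
proof
  assume L: ?L
  then have "(v, w) \<in> parcs (weak_graph n)"
    and H: "(deletion n v, deletion n w) \<in> parcs (weak_graph (n - 1))"
    by (auto simp: horizontal_def)
  then obtain us vs a b where
    vw: "v \<in> permutations_of_set {1..n}" "w \<in> permutations_of_set {1..n}"
      "a < b" "v = us @ a # b # vs" "w = us @ b # a # vs"
    by (auto simp: weak_graph_def)
  have "b \<le> n" using vw by (auto simp: permutations_of_set_def)
  moreover have "b \<noteq> n"
  proof
    assume "b = n"
    then have "deletion n v = deletion n w" using vw by (simp add: deletion_def)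
    with H show False by (metis weak_graph_irrefl)
  qed
  ultimately have "b < n" by simp
  with vw show ?R by blast
next
  assume ?R
  then obtain us vs a b where
    vw: "v \<in> permutations_of_set {1..n}" "w \<in> permutations_of_set {1..n}"
      "a < b" "b < n" "v = us @ a # b # vs" "w = us @ b # a # vs"
    by blast
  have "deletion n v = deletion n us @ [a, b] @ deletion n vs"
    "deletion n w = deletion n us @ [b, a] @ deletion n vs"
    using vw by (auto simp: deletion_def)
  with vw deletion_permutation[OF vw(1)] deletion_permutation[OF vw(2)] show ?L
    unfolding horizontal_def weak_graph_def by force
qed

text \<open>Equal images force \<open>n\<close> to be one of the two letters, and it is the larger one because it is
  the maximum of the alphabet.\<close>

lemma vertical_deletion_iff:
  "(v, w) \<in> vertical (weak_graph n) (deletion n) \<longleftrightarrow>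
     v \<in> permutations_of_set {1..n} \<and> w \<in> permutations_of_set {1..n} \<and>
     (\<exists>p q a. a < n \<and> v = p @ a # n # q \<and> w = p @ n # a # q)"
  (is "?L \<longleftrightarrow> ?R")
proof
  assume L: ?L
  then have "(v, w) \<in> parcs (weak_graph n)" and eq: "deletion n v = deletion n w"
    by (auto simp: vertical_def)
  then obtain us vs a b where
    vw: "v \<in> permutations_of_set {1..n}" "w \<in> permutations_of_set {1..n}"
      "a < b" "v = us @ a # b # vs" "w = us @ b # a # vs"
    by (auto simp: weak_graph_def)
  have "b \<le> n" using vw by (auto simp: permutations_of_set_def)
  then have "b = n" using vw eq by (auto simp: deletion_def split: if_splits)
  with vw show ?R by blast
next
  assume ?R
  then show ?L unfolding vertical_def weak_graph_def
    by (force simp: deletion_def)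
qed

text \<open>Since both swapped letters differ from \<open>n\<close>, they lie on the same side of it.\<close>

lemma right_of_horizontal:
  assumes "(v, w) \<in> horizontal (weak_graph n) (weak_graph (n - 1)) (deletion n)" "n \<ge> 1"
  shows "right_of n v = right_of n w"
proof -
  from assms obtain us vs a b where
    vw: "v \<in> permutations_of_set {1..n}" "w \<in> permutations_of_set {1..n}"
      "a < b" "b < n" "v = us @ a # b # vs" "w = us @ b # a # vs"
    unfolding horizontal_deletion_iff by blast
  have "n \<in> set v" using vw(1) assms(2) by (auto simp: permutations_of_set_def)
  with vw consider "n \<in> set us" | "n \<in> set vs" by auto
  then show ?thesis
  proof cases
    case 1
    then obtain p q where "us = p @ n # q" by (meson split_list)
    with vw right_of_split[of p n "q @ a # b # vs"] right_of_split[of p n "q @ b # a # vs"]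
    show ?thesis by auto
  next
    case 2
    then obtain p q where "vs = p @ n # q" by (meson split_list)
    with vw right_of_split[of "us @ a # b # p" n q] right_of_split[of "us @ b # a # p" n q]
    show ?thesis by auto
  qed
qed

text \<open>A swap of adjacent letters in either order is a horizontal cover or the reverse of one, so
  rearranging a block that avoids \<open>n\<close> stays in the horizontal class. The context \<open>us\<close>, \<open>vs\<close> allows
  this to be used on both sides of \<open>n\<close>.\<close>

lemma equivclp_horizontal_if_adj_swaps:
  assumes "(xs, ys) \<in> adj_swap\<^sup>*" "us @ xs @ vs \<in> permutations_of_set {1..n}" "n \<notin> set xs"
  shows "equivclp (\<lambda>x y. (x, y) \<in> horizontal (weak_graph n) (weak_graph (n - 1)) (deletion n))
           (us @ xs @ vs) (us @ ys @ vs)"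
  using assms(1)
proof (induction rule: rtrancl_induct)
  case (step ys zs)
  have m: "mset xs = mset ys" "mset ys = mset zs"
    using step.hyps by (auto dest: adj_swaps_mset adj_swap_mset)
  have S: "us @ ys @ vs \<in> permutations_of_set {1..n}" "us @ zs @ vs \<in> permutations_of_set {1..n}"
    using assms(2) m permutations_mset_cong[of "us @ xs @ vs" "us @ ys @ vs"]
      permutations_mset_cong[of "us @ ys @ vs" "us @ zs @ vs"] by auto
  obtain l a b r where sw: "ys = l @ a # b # r" "zs = l @ b # a # r"
    using step.hyps(2) by (auto simp: adj_swap_def)
  have "n \<notin> set ys" using assms(3) m by (metis mset_eq_setD)
  then have "a \<noteq> n" "b \<noteq> n" using sw by auto
  moreover have "a \<in> {1..n}" "b \<in> {1..n}"
    unfolding permutations_of_setD(1)[OF S(1), symmetric] sw by simp_all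
  moreover have "a \<noteq> b" using permutations_of_setD(2)[OF S(1)] sw by simp
  ultimately have "a \<noteq> b" "a < n" "b < n" by simp_all
  moreover have "us @ ys @ vs = (us @ l) @ a # b # (r @ vs)"
    "us @ zs @ vs = (us @ l) @ b # a # (r @ vs)" using sw by auto
  ultimately have "(us @ ys @ vs, us @ zs @ vs) \<in> horizontal (weak_graph n) (weak_graph (n - 1)) (deletion n)
    \<or> (us @ zs @ vs, us @ ys @ vs) \<in> horizontal (weak_graph n) (weak_graph (n - 1)) (deletion n)"
    unfolding horizontal_deletion_iff using S by (cases a b rule: linorder_cases) blast+
  with step.IH show ?case by (meson equivclp_into_equivclp)
qed simp

text \<open>Invariance holds cover by cover. Completeness holds because equal sets of letters on the
  right force equal sets on the left, and each side can then be sorted independently.\<close>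

lemma hrel_eq_kernel_right_of:
  assumes "n \<ge> 1"
  shows "hrel (weak_graph n) (weak_graph (n - 1)) (deletion n) =
    {(v, w). v \<in> permutations_of_set {1..n} \<and> w \<in> permutations_of_set {1..n} \<and>
             right_of n v = right_of n w}"
proof -
  let ?E = "equivclp (\<lambda>x y. (x, y) \<in> horizontal (weak_graph n) (weak_graph (n - 1)) (deletion n))"
  have right: "right_of n v = right_of n w" if "?E v w" for v w
    using that
  proof (induction rule: equivclp_induct)
    case (step y z)
    then show ?case using right_of_horizontal[OF _ assms] by metis
  qed simp
  have "?E v w"
    if v: "v \<in> permutations_of_set {1..n}" and w: "w \<in> permutations_of_set {1..n}"
      and eq: "right_of n v = right_of n w" for v w
  proof -
    obtain p q where vs: "v = p @ n # q" using permutation_split[OF v assms] .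
    obtain p' q' where ws: "w = p' @ n # q'" using permutation_split[OF w assms] .
    have q: "set q = set q'" using eq v w by (simp add: vs ws right_of_split)
    then have p: "set p = set p'"
      using parts_of_split(1)[OF v[unfolded vs]] parts_of_split(1)[OF w[unfolded ws]] by simp
    have d: "distinct (p @ n # q)" "distinct (p' @ n # q')"
      using v w by (auto simp: vs ws permutations_of_set_def)
    have "mset p = mset p'" "mset q = mset q'"
      using p q d by (auto simp: set_eq_iff_mset_eq_distinct)
    then have sw: "(p, p') \<in> adj_swap\<^sup>*" "(q, q') \<in> adj_swap\<^sup>*"
      by (auto intro: adj_swaps_if_mset_eq)
    \<comment> \<open>Rearrange the left part first, then the right part.\<close>
    have "?E v (p' @ n # q)"
      using equivclp_horizontal_if_adj_swaps[OF sw(1), of "[]" "n # q" n] v d by (simp add: vs)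
    moreover have "p' @ n # q \<in> permutations_of_set {1..n}"
      using w q d permutations_mset_cong[of "p' @ n # q" w]
      by (simp add: ws \<open>mset q = mset q'\<close>)
    then have "?E (p' @ n # q) w"
      using equivclp_horizontal_if_adj_swaps[OF sw(2), of "p' @ [n]" "[]" n] d by (simp add: ws)
    ultimately show ?thesis by (rule equivclp_trans)
  qed
  with right show ?thesis unfolding hrel_def pverts_weak_graph by blast
qed

section \<open>Quotients by a kernel\<close>

text \<open>On a class of the kernel of \<open>f\<close> the image of \<open>f\<close> is a singleton, so its only element labels
  the class without a choice of representative.\<close>

lemma kernel_quotient:
  fixes f :: "'a \<Rightarrow> 'b" and V :: "'a set"
  defines "r \<equiv> {(v, w). v \<in> V \<and> w \<in> V \<and> f v = f w}"
  shows the_elem_image_class: "w \<in> V \<Longrightarrow> the_elem (f ` (r `` {w})) = f w"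
    and bij_betw_kernel_quotient: "bij_betw (\<lambda>X. the_elem (f ` X)) (V // r) (f ` V)"
proof -
  show class_label: "the_elem (f ` (r `` {w})) = f w" if "w \<in> V" for w
  proof -
    have "f ` (r `` {w}) = {f w}" using that by (auto simp: r_def)
    then show ?thesis by simp
  qed
  show "bij_betw (\<lambda>X. the_elem (f ` X)) (V // r) (f ` V)"
  proof (rule bij_betw_imageI)
    show "inj_on (\<lambda>X. the_elem (f ` X)) (V // r)"
    proof (rule inj_onI)
      fix X Y assume "X \<in> V // r" "Y \<in> V // r"
        and eq: "the_elem (f ` X) = the_elem (f ` Y)"
      then obtain v w where vw: "v \<in> V" "w \<in> V" "X = r `` {v}" "Y = r `` {w}"
        by (auto elim!: quotientE)
      with eq have "f v = f w" by (simp add: class_label)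
      with vw show "X = Y" by (auto simp: r_def)
    qed
    have "V // r = (\<lambda>w. r `` {w}) ` V" by (auto simp: quotient_def)
    then show "(\<lambda>X. the_elem (f ` X)) ` (V // r) = f ` V"
      by (simp add: image_image class_label)
  qed
qed

text \<open>Arcs between classes are the images of arcs between elements, which lets labels be computed
  on representatives.\<close>

lemma quotient_arcs:
  assumes r: "equiv S r" and E: "E \<subseteq> S \<times> S"
  shows "{(X, Y). X \<in> S // r \<and> Y \<in> S // r \<and> (\<exists>v\<in>X. \<exists>w\<in>Y. (v, w) \<in> E)} =
    (\<lambda>(v, w). (r `` {v}, r `` {w})) ` E" (is "?L = ?R")
proof (intro equalityI subrelI)
  have eq: "X = r `` {v}" if X: "X \<in> S // r" and "v \<in> X" for X v
  proof -
    obtain u where "X = r `` {u}" using X by (rule quotientE)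
    with \<open>v \<in> X\<close> equiv_class_eq[OF r] show ?thesis by blast
  qed
  fix X Y assume "(X, Y) \<in> ?L"
  then obtain v w where "X \<in> S // r" "Y \<in> S // r" "v \<in> X" "w \<in> Y" "(v, w) \<in> E"
    by blast
  with eq have "X = r `` {v}" "Y = r `` {w}" by simp_all
  with \<open>(v, w) \<in> E\<close> show "(X, Y) \<in> ?R" by auto
next
  fix X Y assume "(X, Y) \<in> ?R"
  then obtain v w where vw: "(v, w) \<in> E" "X = r `` {v}" "Y = r `` {w}" by auto
  then have "v \<in> S" "w \<in> S" using E by blast+
  then have "v \<in> X \<and> w \<in> Y \<and> X \<in> S // r \<and> Y \<in> S // r"
    unfolding vw by (intro conjI quotientI equiv_class_self[OF r])
  with vw(1) show "(X, Y) \<in> ?L" by blast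
qed

section \<open>Graphs labelled with the Boolean lattice\<close>

definition insertion_arcs :: "'a set \<Rightarrow> 'a set rel" where
  "insertion_arcs U = {(A, A \<union> {a}) | A a. A \<subseteq> U \<and> a \<in> U - A}"

text \<open>If \<open>B\<close> covers \<open>A\<close> and \<open>a\<close> is an element of \<open>B\<close> outside \<open>A\<close>, then \<open>A \<union> {a}\<close> lies between
  them and differs from \<open>A\<close>, hence equals \<open>B\<close>.\<close>

lemma hasse_diagram_boolean_lattice:
  "hasse_diagram (boolean_lattice U) = \<lparr>pverts = Pow U, parcs = insertion_arcs U\<rparr>"
proof -
  let ?covers = "{(A, B) \<in> boolean_lattice U. A \<noteq> B \<and>
    (\<forall>C. (A, C) \<in> boolean_lattice U \<and> (C, B) \<in> boolean_lattice U \<longrightarrow> C = A \<or> C = B)}"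
  have "Field (boolean_lattice U) = Pow U"
    by (auto simp: Field_def boolean_lattice_def)
  moreover have "?covers = insertion_arcs U"
  proof (intro equalityI subrelI)
    fix A B assume "(A, B) \<in> ?covers"
    then have AB: "A \<subseteq> B" "B \<subseteq> U" "A \<noteq> B"
      and between: "\<And>C. \<lbrakk>A \<subseteq> C; C \<subseteq> B; C \<subseteq> U\<rbrakk> \<Longrightarrow> C = A \<or> C = B"
      unfolding boolean_lattice_def by simp_all
    then obtain a where a: "a \<in> B" "a \<notin> A" by blast
    with AB between[of "A \<union> {a}"] have "B = A \<union> {a}" by blast
    with a AB show "(A, B) \<in> insertion_arcs U"
      unfolding insertion_arcs_def by blast
  next
    fix A B assume "(A, B) \<in> insertion_arcs U"
    then obtain a where a: "A \<subseteq> U" "a \<in> U" "a \<notin> A" "B = insert a A"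
      by (auto simp: insertion_arcs_def)
    then have "C = A \<or> C = B" if "A \<subseteq> C" "C \<subseteq> B" for C
      using that by blast
    with a show "(A, B) \<in> ?covers"
      by (auto simp: boolean_lattice_def)
  qed
  ultimately show ?thesis by (simp add: hasse_diagram_def)
qed

text \<open>The consequences for order and acyclicity depend only on the labels, so they are derived
  for an arbitrary graph isomorphic to the Hasse diagram of a finite Boolean lattice.\<close>

locale boolean_labelling =
  fixes R :: "'v pair_pre_digraph" and \<phi> :: "'v \<Rightarrow> 'a set" and U :: "'a set"
  assumes finite_ground: "finite U"
    and bij: "bij_betw \<phi> (pverts R) (Pow U)"
    and arcs_in_verts: "parcs R \<subseteq> pverts R \<times> pverts R"
    and arcs: "map_prod \<phi> \<phi> ` parcs R = insertion_arcs U"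
begin

lemma label_subset: "X \<in> pverts R \<Longrightarrow> \<phi> X \<subseteq> U"
  using bij by (auto simp: bij_betw_def)

lemma label_eqD: "\<lbrakk>X \<in> pverts R; Y \<in> pverts R; \<phi> X = \<phi> Y\<rbrakk> \<Longrightarrow> X = Y"
  using bij by (auto simp: bij_betw_def dest: inj_onD)

lemma arc_label_psubset: "(X, Y) \<in> parcs R \<Longrightarrow> \<phi> X \<subset> \<phi> Y"
proof -
  assume "(X, Y) \<in> parcs R"
  then have "(\<phi> X, \<phi> Y) \<in> insertion_arcs U" unfolding arcs[symmetric] by force
  then show ?thesis by (auto simp: insertion_arcs_def)
qed

lemma arc_if_label_insert:
  assumes "X \<in> pverts R" "Y \<in> pverts R" "a \<in> U - \<phi> X" "\<phi> Y = insert a (\<phi> X)"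
  shows "(X, Y) \<in> parcs R"
proof -
  have "(\<phi> X, \<phi> Y) \<in> map_prod \<phi> \<phi> ` parcs R"
    unfolding arcs insertion_arcs_def using assms label_subset by auto
  then obtain X' Y' where XY': "(X', Y') \<in> parcs R" "\<phi> X' = \<phi> X" "\<phi> Y' = \<phi> Y" by auto
  with assms arcs_in_verts have "X' = X" "Y' = Y" by (auto intro: label_eqD)
  with XY' show ?thesis by simp
qed

lemma acyclic_arcs: "acyclic (parcs R)"
proof -
  have "\<phi> X \<subset> \<phi> Y" if "(X, Y) \<in> (parcs R)\<^sup>+" for X Y
    using that by (induction rule: trancl_induct) (auto dest!: arc_label_psubset)
  then show ?thesis by (force simp: acyclic_def)
qed

lemma reachable_imp_label_subset:
  assumes "(X, Y) \<in> rtrancl_on (pverts R) (parcs R)"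
  shows "\<phi> X \<subseteq> \<phi> Y"
  using assms by (induction rule: rtrancl_on_induct) (auto dest: arc_label_psubset)

text \<open>Induction on the number of elements to be inserted: the last arc into \<open>Y\<close> comes from the
  vertex labelled \<open>\<phi> Y - {a}\<close>, which exists because every subset is a label.\<close>

lemma reachable_if_label_subset:
  assumes "X \<in> pverts R" "Y \<in> pverts R" "\<phi> X \<subseteq> \<phi> Y"
  shows "(X, Y) \<in> rtrancl_on (pverts R) (parcs R)"
  using assms(2,3)
proof (induction "card (\<phi> Y - \<phi> X)" arbitrary: Y)
  case 0
  have "finite (\<phi> Y - \<phi> X)"
    using label_subset[OF 0(2)] finite_ground finite_subset by blast
  with 0 have "\<phi> X = \<phi> Y" by auto
  then have "X = Y" using assms(1) 0(2) by (intro label_eqD)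
  then show ?case using assms(1) by simp
next
  case (Suc k)
  then obtain a where a: "a \<in> \<phi> Y" "a \<notin> \<phi> X"
    by (metis Diff_iff card_eq_SucD insertI1)
  have "\<phi> Y - {a} \<in> Pow U" using label_subset[OF Suc.prems(1)] by auto
  then obtain Z where Z: "Z \<in> pverts R" "\<phi> Z = \<phi> Y - {a}"
    using bij by (metis bij_betw_imp_surj_on imageE)
  have "\<phi> Z - \<phi> X = (\<phi> Y - \<phi> X) - {a}" using Z by auto
  then have "card (\<phi> Z - \<phi> X) = k" using Suc.hyps(2) a by simp
  then have "(X, Z) \<in> rtrancl_on (pverts R) (parcs R)"
    using Suc.hyps(1)[of Z] Z Suc.prems a by auto
  moreover have "(Z, Y) \<in> parcs R"
    using Z a Suc.prems label_subset by (intro arc_if_label_insert[of _ _ a]) auto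
  ultimately show ?case using Suc.prems(1) by (rule rtrancl_on_into_rtrancl_on)
qed

lemma reachability_order_iff:
  "(X, Y) \<in> reachability_order R \<longleftrightarrow> X \<in> pverts R \<and> Y \<in> pverts R \<and> \<phi> X \<subseteq> \<phi> Y"
proof -
  have "(X, Y) \<in> reachability_order R \<longleftrightarrow> (X, Y) \<in> rtrancl_on (pverts R) (parcs R)"
    by (simp add: reachability_order_def reachable_def)
  also have "\<dots> \<longleftrightarrow> X \<in> pverts R \<and> Y \<in> pverts R \<and> \<phi> X \<subseteq> \<phi> Y"
    using reachable_imp_label_subset reachable_if_label_subset
    by (blast dest: in_rtrancl_on_in_F)
  finally show ?thesis .
qed

lemma partial_order_reachability: "partial_order_on (pverts R) (reachability_order R)"
  unfolding partial_order_on_def preorder_on_def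
  by (auto simp: reachability_order_iff refl_on_def trans_def antisym_def intro: label_eqD)

end

section \<open>The pre-Reeb graph\<close>

text \<open>A vertical cover moves \<open>n\<close> to the left over one letter \<open>a\<close>, which joins the right part.
  Conversely, for given \<open>A\<close> and \<open>a\<close> the letters outside \<open>A \<union> {a}\<close> and those of \<open>A\<close> can be written in
  any order around \<open>a n\<close>; increasing order serves.\<close>

lemma right_of_vertical:
  "(\<lambda>(v, w). (right_of n v, right_of n w)) ` vertical (weak_graph n) (deletion n)
    = insertion_arcs {1..n - 1}" (is "?L = ?R")
proof (intro equalityI subrelI)
  fix A B assume "(A, B) \<in> ?L"
  then obtain u w where "(u, w) \<in> vertical (weak_graph n) (deletion n)"
    "A = right_of n u" "B = right_of n w" by auto
  then obtain p q a where v: "p @ a # n # q \<in> permutations_of_set {1..n}"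
    and w: "p @ n # a # q \<in> permutations_of_set {1..n}"
    and AB: "A = right_of n (p @ a # n # q)" "B = right_of n (p @ n # a # q)"
    unfolding vertical_deletion_iff by blast
  have "A = set q" "B = insert a (set q)"
    using AB v w right_of_split[of "p @ [a]" n q] right_of_split[of p n "a # q"] by simp_all
  moreover have "insert a (set q) \<subseteq> {1..n - 1}" using parts_of_split(2)[OF w] by simp
  moreover have "a \<notin> set q" using permutations_of_setD(2)[OF v] by simp
  ultimately show "(A, B) \<in> ?R" unfolding insertion_arcs_def by blast
next
  fix A B assume "(A, B) \<in> ?R"
  then obtain a where A: "A \<subseteq> {1..n - 1}" "a \<in> {1..n - 1}" "a \<notin> A" "B = insert a A"
    by (auto simp: insertion_arcs_def)
  then have "finite A" using finite_subset by blast
  let ?q = "sorted_list_of_set A" and ?p = "sorted_list_of_set ({1..n - 1} - insert a A)"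
  have v: "(?p @ [a]) @ n # ?q \<in> permutations_of_set {1..n}"
    using A \<open>finite A\<close> by (intro permutation_with_right_part) auto
  have w: "?p @ n # a # ?q \<in> permutations_of_set {1..n}"
    using A \<open>finite A\<close> by (intro permutation_with_right_part) auto
  have "a < n" using A(2) by auto
  have "(?p @ a # n # ?q, ?p @ n # a # ?q) \<in> vertical (weak_graph n) (deletion n)"
    unfolding vertical_deletion_iff using v w \<open>a < n\<close> by simp blast
  moreover have "right_of n (?p @ a # n # ?q) = A" "right_of n (?p @ n # a # ?q) = B"
    using right_of_split[OF v] right_of_split[OF w] A \<open>finite A\<close> by auto
  ultimately show "(A, B) \<in> ?L" by (metis (mono_tags, lifting) case_prod_conv image_eqI)
qed

lemma pre_reeb_label_arcs:
  fixes n :: nat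
  assumes "n \<ge> 1"
  shows "map_prod (\<lambda>X. the_elem (right_of n ` X)) (\<lambda>X. the_elem (right_of n ` X)) `
      parcs (pre_reeb (weak_graph n) (weak_graph (n - 1)) (deletion n)) = insertion_arcs {1..n - 1}"
    (is "map_prod ?\<phi> ?\<phi> ` parcs ?R = _")
proof -
  let ?r = "hrel (weak_graph n) (weak_graph (n - 1)) (deletion n)"
  let ?S = "permutations_of_set {1..n}"
  let ?V = "vertical (weak_graph n) (deletion n)"
  note r = hrel_eq_kernel_right_of[OF assms]
  have class_label: "?\<phi> (?r `` {w}) = right_of n w" if "w \<in> ?S" for w
    unfolding r by (rule the_elem_image_class[OF that])
  have VS: "v \<in> ?S \<and> w \<in> ?S" if "(v, w) \<in> ?V" for v w
    using that by (simp add: vertical_deletion_iff)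
  have "equiv ?S ?r"
    unfolding r equiv_def refl_on_def sym_def trans_def by blast
  moreover have "?V \<subseteq> ?S \<times> ?S" by (rule subrelI) (simp only: VS mem_Sigma_iff)
  ultimately have "parcs ?R = (\<lambda>(v, w). (?r `` {v}, ?r `` {w})) ` ?V"
    by (simp only: quotient_arcs[symmetric] pre_reeb_def pverts_weak_graph
        pair_pre_digraph.select_convs)
  also have "map_prod ?\<phi> ?\<phi> ` \<dots> = (\<lambda>(v, w). (right_of n v, right_of n w)) ` ?V"
    unfolding image_image using VS class_label by (intro image_cong) auto
  finally show ?thesis by (simp only: right_of_vertical)
qed

theorem proposition2p2:
  fixes n :: nat
  assumes "n \<ge> 2"
  defines "G \<equiv> weak_graph n" and "H \<equiv> weak_graph (n - 1)"
  defines "R \<equiv> pre_reeb G H (deletion n)"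
  shows "\<exists>\<phi> :: nat list set \<Rightarrow> nat set.
      (\<forall>w \<in> permutations_of_set {1..n}. \<phi> (hrel G H (deletion n) `` {w}) = right_of n w) \<and>
      bij_betw \<phi> (pverts R) (Pow {1..n - 1}) \<and>
      map_prod \<phi> \<phi> ` parcs R = {(A, A \<union> {a}) | A a. A \<subseteq> {1..n - 1} \<and> a \<in> {1..n - 1} - A} \<and>
      relabel \<phi> R = hasse_diagram (boolean_lattice {1..n - 1}) \<and>
      acyclic (parcs R) \<and>
      partial_order_on (pverts R) (reachability_order R) \<and>
      (\<forall>X \<in> pverts R. \<forall>Y \<in> pverts R.
         (X, Y) \<in> reachability_order R \<longleftrightarrow> (\<phi> X, \<phi> Y) \<in> boolean_lattice {1..n - 1})"
proof -
  define \<phi> :: "nat list set \<Rightarrow> nat set" where "\<phi> X = the_elem (right_of n ` X)" for X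
  have n: "n \<ge> 1" using assms(1) by simp
  note kernel = hrel_eq_kernel_right_of[OF n, folded G_def H_def]
  have class_label: "\<forall>w \<in> permutations_of_set {1..n}. \<phi> (hrel G H (deletion n) `` {w}) = right_of n w"
    unfolding kernel \<phi>_def by (intro ballI the_elem_image_class)
  have "pverts R = permutations_of_set {1..n} // hrel G H (deletion n)"
    by (simp add: R_def pre_reeb_def G_def weak_graph_def)
  then have bij: "bij_betw \<phi> (pverts R) (Pow {1..n - 1})"
    using bij_betw_kernel_quotient[of "right_of n" "permutations_of_set {1..n}"]
    unfolding kernel range_right_of[OF n] \<phi>_def[abs_def] by simp
  have arcs: "map_prod \<phi> \<phi> ` parcs R = insertion_arcs {1..n - 1}"
    unfolding \<phi>_def[abs_def] R_def G_def H_def by (rule pre_reeb_label_arcs[OF n])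
  interpret boolean_labelling R \<phi> "{1..n - 1}"
    using bij arcs by unfold_locales (auto simp: R_def pre_reeb_def)
  have "relabel \<phi> R = hasse_diagram (boolean_lattice {1..n - 1})"
    using bij arcs by (simp add: relabel_def hasse_diagram_boolean_lattice bij_betw_def)
  moreover have "(X, Y) \<in> reachability_order R \<longleftrightarrow> (\<phi> X, \<phi> Y) \<in> boolean_lattice {1..n - 1}"
    if "X \<in> pverts R" "Y \<in> pverts R" for X Y
    using that label_subset by (auto simp: reachability_order_iff boolean_lattice_def)
  ultimately show ?thesis
    using class_label bij arcs[unfolded insertion_arcs_def] acyclic_arcs partial_order_reachability
    by blast
qed

end
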